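(* Let $n_1,n_2\ge 1$, $n=n_1+n_2$, let $\boldsymbol\mu_1,\boldsymbol\mu_2\in\mathbb{R}^p$ with $\boldsymbol\mu_1\ne\boldsymbol\mu_2$ and $\boldsymbol\mu_2\neq 0$, and put $c_{11}=\|\boldsymbol\mu_1\|_2^2$, $c_{22}=\|\boldsymbol\mu_2\|_2^2$, $c_{12}=\boldsymbol\mu_1^\top\boldsymbol\mu_2$. Let $\mathbf{a}_1\in\{0,1\}^n$ have exactly $n_1$ entries equal to $1$, let $\mathbf{a}_2=\mathbf{1}-\mathbf{a}_1$, and let $$\mathbf{H}=c_{11}\mathbf{a}_1\mathbf{a}_1^\top+c_{22}\mathbf{a}_2\mathbf{a}_2^\top+c_{12}\mathbf{a}_1\mathbf{a}_2^\top+c_{12}\mathbf{a}_2\mathbf{a}_1^\top .$$ Let $d_1^2\ge d_2^2\ge 0$ be the two largest eigenvalues of $\mathbf{H}$ and $\mathbf{u}_1,\mathbf{u}_2$ corresponding orthonormal eigenvectors. Then $$d^2_1=\tfrac{1}{2}\left(n_1c_{11}+n_2c_{22}+(n_1^2c_{11}^2+n_2^2c_{22}^2+4n_1n_2c_{12}^2-2n_1n_2c_{11}c_{22})^{1/2}\right),$$ $$d^2_2=\tfrac{1}{2}\left(n_1c_{11}+n_2c_{22}-(n_1^2c_{11}^2+n_2^2c_{22}^2+4n_1n_2c_{12}^2-2n_1n_2c_{11}c_{22})^{1/2}\right).$$ Moreover: (a) If $c_{12}^2=c_{11}c_{22}$, then $d_1^2=n_1c_{11}+n_2c_{22}$ and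 $d_2^2=0$, and only $\mathbf{u}_1$ has clustering power. (b) If $c_{12}^2\ne c_{11}c_{22}$, $c_{12}=0$ and $n_1c_{11}=n_2c_{22}$, then $d_1^2=d_2^2=n_1c_{11}$ and at least one of $\mathbf{u}_1,\mathbf{u}_2$ has clustering power. (c) If $c_{12}^2\ne c_{11}c_{22}$, $c_{12}=0$ and $n_1c_{11}\ne n_2c_{22}$, then $d_1^2=\max\{n_1c_{11},n_2c_{22}\}$ and $d_2^2=\min\{n_1c_{11},n_2c_{22}\}>0$, and both $\mathbf{u}_1$ and $\mathbf{u}_2$ have clustering power. (d) If $c_{12}^2\ne c_{11}c_{22}$ and $c_{12}\ne 0$: if $n_1c_{11}+n_2c_{12}=n_2c_{22}+n_1c_{12}$, then exactly one of $\mathbf{u}_1,\mathbf{u}_2$ has clustering power; if $n_1c_{11}+n_2c_{12}\ne n_2c_{22}+n_1c_{12}$, then both have clustering power.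
   Context: Definition: an eigenvector $\mathbf{u}_k$ ($k=1,2$) of $\mathbf{H}$ is said to have clustering power if its corresponding eigenvalue $d_k^2$ is positive and its coordinates take exactly two distinct values. Background: $\mathbf{H}=(\mathbb{E}\mathbf{X})^\top\mathbb{E}\mathbf{X}$, where $\mathbf{X}=(\mathbf{x}_1,\dots,\mathbf{x}_n)$ is the $p\times n$ data matrix with $\mathbf{x}_i=Y_i\boldsymbol\mu_1+(1-Y_i)\boldsymbol\mu_2+\mathbf{w}_i$, with deterministic labels $Y_i\in\{0,1\}$, centered noise $\mathbf{w}_i$, and $\mathbf{a}_1=(Y_1,\dots,Y_n)^\top$. *)

theory Defs
  imports Complex_Main "HOL-Library.Multiset" "Jordan_Normal_Form.Char_Poly"
begin

definition l2_norm :: "real vec \<Rightarrow> real" where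
  "l2_norm v = sqrt (\<Sum>i<dim_vec v. (v $ i)\<^sup>2)"

definition outer_prod :: "real vec \<Rightarrow> real vec \<Rightarrow> real mat" where
  "outer_prod v w = mat (dim_vec v) (dim_vec w) (\<lambda>(i, j). v $ i * w $ j)"

text \<open>
  The real eigenvalues of a matrix, repeated according to their multiplicity as roots of the
  characteristic polynomial, in decreasing order. For a symmetric matrix of dimension \<open>n\<close> this
  list has length \<open>n\<close>, and the multiplicities are also those of the eigenspaces.
\<close>
definition eigenvalues_desc :: "real mat \<Rightarrow> real list" where
  "eigenvalues_desc A = rev (sorted_list_of_multiset (proots (char_poly A)))"

definition orthonormal_pair :: "real vec \<Rightarrow> real vec \<Rightarrow> bool" where
  "orthonormal_pair u v \<longleftrightarrow> l2_norm u = 1 \<and> l2_norm v = 1 \<and> u \<bullet> v = 0"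

text \<open>
  An eigenvector is nonzero by definition, so the eigenvalue \<open>d\<close> below is uniquely determined
  by the vector.
\<close>
definition clustering_power :: "real mat \<Rightarrow> real vec \<Rightarrow> bool" where
  "clustering_power A u \<longleftrightarrow> (\<exists>d. eigenvector A u d \<and> d > 0) \<and> card (vec_set u) = 2"

end

theory Submission
  imports Defs
begin

text \<open>
  \<open>H\<close> factors through \<open>\<real>\<^sup>2\<close>: writing \<open>A = (a\<^sub>1, a\<^sub>2)\<close> and \<open>C\<close> for the Gram matrix of the means,
  \<open>H = A (C A\<^sup>T)\<close>, so its nonzero spectrum is that of the \<open>2 \<times> 2\<close> matrix \<open>(C A\<^sup>T) A\<close>, which has
  trace \<open>n\<^sub>1 c\<^sub>1\<^sub>1 + n\<^sub>2 c\<^sub>2\<^sub>2\<close> and determinant \<open>n\<^sub>1 n\<^sub>2 (c\<^sub>1\<^sub>1 c\<^sub>2\<^sub>2 - c\<^sub>1\<^sub>2\<^sup>2) \<ge> 0\<close>. An eigenvector for a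
  nonzero eigenvalue is constant on each cluster, hence has clustering power iff it is not
  constant. The constant vector is an eigenvector iff
  \<open>n\<^sub>1 c\<^sub>1\<^sub>1 + n\<^sub>2 c\<^sub>1\<^sub>2 = n\<^sub>2 c\<^sub>2\<^sub>2 + n\<^sub>1 c\<^sub>1\<^sub>2\<close>, and by orthogonality at most one of \<open>u\<^sub>1, u\<^sub>2\<close> is constant.
\<close>

section \<open>Characteristic polynomials of products and ordered spectra\<close>

text \<open>Sylvester's determinant identity. Passing through characteristic polynomials keeps track
  of multiplicities, and powers of X on both sides avoid a case distinction on the order of
  \<open>n\<close> and \<open>k\<close>.\<close>

lemma char_poly_mult_swap:
  fixes A B :: "'a :: idom mat"
  assumes A: "A \<in> carrier_mat n k" and B: "B \<in> carrier_mat k n"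
  shows "[:0, 1:] ^ k * char_poly (A * B) = [:0, 1:] ^ n * char_poly (B * A)"
proof -
  define X :: "'a poly" where "X = [:0, 1:]"
  define P where "P = map_mat (\<lambda>a. [:a:]) A"
  define Q where "Q = map_mat (\<lambda>a. [:a:]) B"
  have P: "P \<in> carrier_mat n k" and Q: "Q \<in> carrier_mat k n"
    using A B by (auto simp: P_def Q_def)
  have neg: "map_mat (\<lambda>a. [:- a:]) C = - map_mat (\<lambda>a. [:a:]) C" for C :: "'a mat"
    by (intro eq_matI) auto
  have AB: "char_poly (A * B) = det (X \<cdot>\<^sub>m 1\<^sub>m n + - (P * Q))"
    using A unfolding char_poly_defs neg map_poly_mult(1)[OF A B]
    by (simp add: X_def P_def Q_def)
  have BA: "char_poly (B * A) = det (- (Q * P) + X \<cdot>\<^sub>m 1\<^sub>m k)"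
    using B P Q unfolding char_poly_defs neg map_poly_mult(1)[OF B A]
    by (subst comm_add_mat[of _ k k]) (auto simp: X_def P_def Q_def)
  \<comment> \<open>A bordered matrix with both characteristic polynomials as Schur complements.\<close>
  define M where "M = four_block_mat (X \<cdot>\<^sub>m 1\<^sub>m n) P Q (1\<^sub>m k)"
  have M: "M \<in> carrier_mat (n + k) (n + k)"
    by (simp add: M_def)
  \<comment> \<open>Both multipliers clear the lower left block of \<open>M\<close>:
    \<open>L\<close> from the right, leaving X - PQ in the upper left, and \<open>R\<close> from the
    left, leaving X - QP in the lower right. The block X in \<open>R\<close> avoids dividing by X
    and costs the factor \<open>X ^ k\<close>, its determinant.\<close>
  define L where "L = four_block_mat (1\<^sub>m n) (0\<^sub>m n k) (- Q) (1\<^sub>m k)"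
  define R where "R = four_block_mat (1\<^sub>m n) (0\<^sub>m n k) (- Q) (X \<cdot>\<^sub>m 1\<^sub>m k)"
  have L: "L \<in> carrier_mat (n + k) (n + k)" and R: "R \<in> carrier_mat (n + k) (n + k)"
    by (simp_all add: L_def R_def)
  have MtimesL: "M * L = four_block_mat (X \<cdot>\<^sub>m 1\<^sub>m n + - (P * Q)) P (0\<^sub>m k n) (1\<^sub>m k)"
    unfolding M_def L_def
    by (subst mult_four_block_mat[of _ n n _ k _ k _ _ n _ k])
      (use P Q in \<open>auto intro!: cong_four_block_mat\<close>)
  have RtimesM: "R * M = four_block_mat (X \<cdot>\<^sub>m 1\<^sub>m n) P (0\<^sub>m k n) (- (Q * P) + X \<cdot>\<^sub>m 1\<^sub>m k)"
    unfolding M_def R_def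
    by (subst mult_four_block_mat[of _ n n _ k _ k _ _ n _ k])
      (use P Q in \<open>auto intro!: cong_four_block_mat
         simp: mult_smult_distrib[of _ k n] mult_smult_assoc_mat[of _ k k]\<close>)
  have "det M = char_poly (A * B)"
  proof -
    have "det M * det L = det (M * L)" using det_mult[OF M L] by simp
    also have "\<dots> = char_poly (A * B)"
      unfolding MtimesL AB by (subst det_four_block_mat_lower_left_zero[of _ n _ k]) (use P Q in auto)
    also have "det L = 1"
      unfolding L_def by (subst det_four_block_mat_upper_right_zero[of _ n _ k]) (use Q in auto)
    finally show ?thesis by simp
  qed
  moreover have "X ^ k * det M = X ^ n * char_poly (B * A)"
  proof -
    have "det R * det M = det (R * M)" using det_mult[OF R M] by simp
    also have "\<dots> = X ^ n * char_poly (B * A)"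
      unfolding RtimesM BA by (subst det_four_block_mat_lower_left_zero[of _ n _ k]) (use P Q in auto)
    also have "det R = X ^ k"
      unfolding R_def by (subst det_four_block_mat_upper_right_zero[of _ n _ k]) (use Q in auto)
    finally show ?thesis .
  qed
  ultimately show ?thesis by (simp add: X_def)
qed

lemma char_poly_2x2:
  fixes A :: "'a :: idom mat"
  assumes A: "A \<in> carrier_mat 2 2"
  shows "char_poly A = [: A $$ (0,0) * A $$ (1,1) - A $$ (0,1) * A $$ (1,0),
                          - (A $$ (0,0) + A $$ (1,1)), 1 :]"
proof -
  have c: "char_poly_matrix A \<in> carrier_mat 2 2" using A by simp
  show ?thesis
    unfolding char_poly_def
    by (subst laplace_expansion_column[OF c, of 0])
      (use A in \<open>auto simp: cofactor_def mat_delete_def det_single char_poly_matrix_def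
         numeral_2_eq_2 lessThan_Suc\<close>)
qed

text \<open>Since \<open>b\<close> is nonnegative the zeros come last, so \<open>a\<close> and
  \<open>b\<close> are the entries 0 and 1 that the theorem calls the two largest
  eigenvalues.\<close>

lemma eigenvalues_desc_eq:
  assumes "proots (char_poly A) = {#a, b#} + replicate_mset m 0" "a \<ge> b" "b \<ge> 0"
  shows "eigenvalues_desc A = a # b # replicate m 0"
proof -
  have "proots (char_poly A) = mset (replicate m 0 @ [b, a])"
    using assms(1) by (simp add: add_mset_commute)
  moreover have "sorted (replicate m 0 @ [b, a])"
    using assms(2,3) by (auto simp: sorted_append)
  ultimately show ?thesis
    by (simp add: eigenvalues_desc_def sorted_sort_id del: mset_append)
qed

section \<open>Spectrum and eigenvectors of a matrix constant on cluster blocks\<close>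

text \<open>The coefficients are arbitrary reals here; that they are inner products of the means
  enters only in the theorem.\<close>

locale two_block_gram =
  fixes n1 n2 n :: nat and a1 a2 :: "real vec" and c11 c22 c12 :: real and H :: "real mat"
  assumes n1: "n1 \<ge> 1" and n2: "n2 \<ge> 1" and n: "n = n1 + n2"
    and a1: "a1 \<in> carrier_vec n" "\<forall>i<n. a1 $ i \<in> {0, 1}"
    and a1_card: "card {i. i < n \<and> a1 $ i = 1} = n1"
    and a2: "a2 = vec n (\<lambda>_. 1) - a1"
    and H: "H = c11 \<cdot>\<^sub>m outer_prod a1 a1 + c22 \<cdot>\<^sub>m outer_prod a2 a2
              + c12 \<cdot>\<^sub>m outer_prod a1 a2 + c12 \<cdot>\<^sub>m outer_prod a2 a1"
begin

lemma card_block2: "card {i. i < n \<and> a1 $ i \<noteq> 1} = n2"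
proof -
  have "{i. i < n \<and> a1 $ i \<noteq> 1} = {..<n} - {i. i < n \<and> a1 $ i = 1}" by auto
  moreover have "card ({..<n} - {i. i < n \<and> a1 $ i = 1}) = n - n1"
    by (subst card_Diff_subset) (auto simp: a1_card)
  ultimately show ?thesis using n by simp
qed

text \<open>Reduces matrix products, eigenvalue equations and inner products of block vectors to two
  terms weighted by the cluster sizes.\<close>

lemma sum_blocks:
  fixes x y :: real
  shows "(\<Sum>i = 0..<n. if a1 $ i = 1 then x else y) = n1 * x + n2 * y"
proof -
  have "{0..<n} \<inter> {i. a1 $ i = 1} = {i. i < n \<and> a1 $ i = 1}"
    "{0..<n} \<inter> - {i. a1 $ i = 1} = {i. i < n \<and> a1 $ i \<noteq> 1}" by auto
  then show ?thesis
    using a1_card card_block2 by (simp add: sum.If_cases)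
qed

lemma a2_index: "i < n \<Longrightarrow> a2 $ i = (if a1 $ i = 1 then 0 else 1)"
  using a1 a2 by auto

lemma a2_dim: "a2 \<in> carrier_vec n"
  using a1 a2 by auto

lemma H_carrier: "H \<in> carrier_mat n n"
  using a1 a2_dim H by (auto simp: outer_prod_def)

lemma H_index:
  assumes "i < n" "j < n"
  shows "H $$ (i, j) = (if a1 $ i = 1 then if a1 $ j = 1 then c11 else c12
                                      else if a1 $ j = 1 then c12 else c22)"
proof -
  have "H $$ (i, j) = c11 * (a1 $ i * a1 $ j) + c22 * (a2 $ i * a2 $ j)
          + c12 * (a1 $ i * a2 $ j) + c12 * (a2 $ i * a1 $ j)"
    using assms a1 a2_dim H by (auto simp: outer_prod_def)
  moreover have "a1 $ i = 0 \<or> a1 $ i = 1" "a1 $ j = 0 \<or> a1 $ j = 1"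
    using a1(2) assms by auto
  ultimately show ?thesis
    using a2_index[OF assms(1)] a2_index[OF assms(2)] by auto
qed

lemma H_char_poly:
  "[:0, 1:] ^ 2 * char_poly H
     = [:0, 1:] ^ n * [: n1 * n2 * (c11 * c22 - c12\<^sup>2), - (n1 * c11 + n2 * c22), 1 :]"
proof -
  define A where "A = mat n 2 (\<lambda>(i, j). if j = 0 then a1 $ i else a2 $ i)"
  \<comment> \<open>The product of the Gram matrix with the transpose of \<open>A\<close>, written
    entrywise: column \<open>j\<close> is the Gram column selected by the cluster of
    \<open>j\<close>.\<close>
  define B where "B = mat 2 n (\<lambda>(i, j). if a1 $ j = 1 then if i = 0 then c11 else c12
                                       else if i = 0 then c12 else c22)"
  have A: "A \<in> carrier_mat n 2" and B: "B \<in> carrier_mat 2 n"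
    by (simp_all add: A_def B_def)
  have "A * B = H"
  proof (rule eq_matI)
    fix i j assume "i < dim_row H" "j < dim_col H"
    with H_carrier have ij: "i < n" "j < n" by auto
    then show "(A * B) $$ (i, j) = H $$ (i, j)"
      using A B a2_index[OF ij(1)] a1(2) 
      by (auto simp: H_index[OF ij] A_def B_def scalar_prod_def numeral_2_eq_2)
  qed (use A B H_carrier in auto)
  moreover have "(B * A) $$ (i, j) = (if j = 0 then n1 * (if i = 0 then c11 else c12)
                                       else n2 * (if i = 0 then c12 else c22))"
    if "i < 2" "j < 2" for i j
  proof -
    have "(B * A) $$ (i, j) = (\<Sum>k = 0..<n. B $$ (i, k) * A $$ (k, j))"
      using A B that by (simp add: scalar_prod_def)
    also have "\<dots> = (\<Sum>k = 0..<n. if a1 $ k = 1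
        then (if j = 0 then if i = 0 then c11 else c12 else 0)
        else (if j = 0 then 0 else if i = 0 then c12 else c22))"
      by (intro sum.cong refl) (use that a1(2) in \<open>auto simp: A_def B_def a2_index\<close>)
    finally show ?thesis unfolding sum_blocks by simp
  qed
  ultimately show ?thesis
    using char_poly_mult_swap[OF A B] char_poly_2x2[of "B * A"] A B
    by (simp add: algebra_simps power2_eq_square)
qed

text \<open>By Vieta the first two hypotheses say that the quadratic factor in
  \<open>H_char_poly\<close> is (X - a)(X - b), so no square root appears here.\<close>

lemma eigenvalues:
  assumes "n1 * c11 + n2 * c22 = a + b" "n1 * n2 * (c11 * c22 - c12\<^sup>2) = a * b" "a \<ge> b" "b \<ge> 0"
  shows "eigenvalues_desc H = a # b # replicate (n - 2) 0"
proof (rule eigenvalues_desc_eq[OF _ assms(3,4)])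
  have nz: "char_poly H \<noteq> 0"
    using degree_monic_char_poly[OF H_carrier] by auto
  have "[:0, 1:] ^ 2 * char_poly H = [:0, 1:] ^ n * ([:- a, 1:] * [:- b, 1:])"
    unfolding H_char_poly assms(1,2) by (simp add: algebra_simps)
  \<comment> \<open>The power of X is cancelled among roots: two zeros on the left against two of
    the \<open>n\<close> zeros on the right, with \<open>n\<close> at least 2 because both clusters
    are nonempty.\<close>
  from arg_cong[OF this, of proots]
  have "repeat_mset 2 {#0#} + proots (char_poly H) = repeat_mset n {#0#} + {#a, b#}"
    using nz by (simp add: proots_mult proots_power del: mult_pCons_left mult_pCons_right)
  moreover have "repeat_mset n {#0#} = {#0, 0#} + replicate_mset (n - 2) (0 :: real)"
    using n n1 n2 by (intro multiset_eqI) auto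
  ultimately show "proots (char_poly H) = {#a, b#} + replicate_mset (n - 2) 0"
    by (simp add: numeral_2_eq_2)
qed

text \<open>Row \<open>i\<close> of \<open>H\<close> depends only on the cluster of
  \<open>i\<close>, hence so does entry \<open>i\<close> of Hu = du; dividing by \<open>d\<close>
  carries this over to \<open>u\<close>. Both clusters are nonempty, so both values occur among the
  coordinates.\<close>

lemma block_eigenvector:
  assumes ev: "eigenvector H u d" and d: "d \<noteq> 0"
  obtains \<alpha> \<beta> where "u = vec n (\<lambda>i. if a1 $ i = 1 then \<alpha> else \<beta>)"
    and "d * \<alpha> = n1 * c11 * \<alpha> + n2 * c12 * \<beta>" and "d * \<beta> = n1 * c12 * \<alpha> + n2 * c22 * \<beta>"
    and "\<alpha> \<noteq> 0 \<or> \<beta> \<noteq> 0" and "card (vec_set u) = 2 \<longleftrightarrow> \<alpha> \<noteq> \<beta>"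
proof -
  have "{i. i < n \<and> a1 $ i = 1} \<noteq> {}" "{i. i < n \<and> a1 $ i \<noteq> 1} \<noteq> {}"
    using a1_card card_block2 n1 n2 by (auto simp del: Collect_empty_eq)
  then obtain i1 i2 where i1: "i1 < n" "a1 $ i1 = 1" and i2: "i2 < n" "a1 $ i2 \<noteq> 1"
    by blast
  have u: "u \<in> carrier_vec n" "u \<noteq> 0\<^sub>v n" and Hu: "H *\<^sub>v u = d \<cdot>\<^sub>v u"
    using ev H_carrier by (auto simp: eigenvector_def)
  have eq: "d * u $ i = (\<Sum>j = 0..<n. H $$ (i, j) * u $ j)" if "i < n" for i
    using arg_cong[OF Hu, of "\<lambda>v. v $ i"] u(1) H_carrier that
    by (simp add: scalar_prod_def)
  define \<alpha> \<beta> where "\<alpha> = u $ i1" and "\<beta> = u $ i2"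
  have u_index: "u $ i = (if a1 $ i = 1 then \<alpha> else \<beta>)" if "i < n" for i
  proof -
    have "d * u $ i = d * u $ (if a1 $ i = 1 then i1 else i2)"
      using that i1 i2 by (simp add: eq H_index)
    then show ?thesis using d by (simp add: \<alpha>_def \<beta>_def)
  qed
  have u_eq: "u = vec n (\<lambda>i. if a1 $ i = 1 then \<alpha> else \<beta>)"
    using u(1) u_index by (intro eq_vecI) auto
  have "d * \<alpha> = (\<Sum>j = 0..<n. if a1 $ j = 1 then c11 * \<alpha> else c12 * \<beta>)"
    unfolding \<alpha>_def eq[OF i1(1)]
    by (intro sum.cong refl) (use i1 in \<open>auto simp: H_index u_index \<alpha>_def[symmetric]\<close>)
  moreover have "d * \<beta> = (\<Sum>j = 0..<n. if a1 $ j = 1 then c12 * \<alpha> else c22 * \<beta>)"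
    unfolding \<beta>_def eq[OF i2(1)]
    by (intro sum.cong refl) (use i2 in \<open>auto simp: H_index u_index \<beta>_def[symmetric]\<close>)
  moreover have "\<alpha> \<noteq> 0 \<or> \<beta> \<noteq> 0"
    using u u_index by (auto simp: vec_eq_iff)
  moreover have "vec_set u = {\<alpha>, \<beta>}"
    using i1 i2 by (auto simp: vec_set_def u_eq image_iff)
  then have "card (vec_set u) = 2 \<longleftrightarrow> \<alpha> \<noteq> \<beta>"
    by (cases "\<alpha> = \<beta>") auto
  ultimately show ?thesis
    using that u_eq by (simp add: sum_blocks mult.assoc)
qed

end

section \<open>Clustering power and positivity of the Gram form\<close>

text \<open>A nonzero vector has only one eigenvalue, so the existential in the definition can be
  tested at the given \<open>d\<close>.\<close>

lemma clustering_power_iff: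
  assumes "eigenvector H u d"
  shows "clustering_power H u \<longleftrightarrow> d > 0 \<and> card (vec_set u) = 2"
proof -
  have "e = d" if "eigenvector H u e" for e
  proof -
    have u: "u \<in> carrier_vec (dim_row H)" "u \<noteq> 0\<^sub>v (dim_row H)" and eq: "e \<cdot>\<^sub>v u = d \<cdot>\<^sub>v u"
      using assms that by (auto simp: eigenvector_def)
    obtain i where i: "i < dim_row H" "u $ i \<noteq> 0"
      using u by (auto simp: vec_eq_iff)
    have "e * u $ i = d * u $ i"
      using arg_cong[OF eq, of "\<lambda>v. v $ i"] u(1) i(1) by simp
    then show ?thesis using i(2) by simp
  qed
  then show ?thesis
    using assms unfolding clustering_power_def by blast
qed

text \<open>The coefficients stay free because different choices yield the norm of a mean, the
  distance of the means, and the Cauchy-Schwarz inequality.\<close>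

lemma gram_quadratic:
  assumes "v \<in> carrier_vec p" "w \<in> carrier_vec p"
  shows "(\<Sum>i<p. (x * v $ i + y * w $ i)\<^sup>2)
           = x\<^sup>2 * (l2_norm v)\<^sup>2 + 2 * x * y * (v \<bullet> w) + y\<^sup>2 * (l2_norm w)\<^sup>2"
proof -
  have "(l2_norm u)\<^sup>2 = (\<Sum>i<p. (u $ i)\<^sup>2)" if "u \<in> carrier_vec p" for u
    using that by (simp add: l2_norm_def sum_nonneg)
  then show ?thesis
    using assms
    by (simp add: scalar_prod_def lessThan_atLeast0 power2_sum power_mult_distrib sum.distrib
        sum_distrib_left mult_ac)
qed

lemma gram_positive:
  assumes "v \<in> carrier_vec p" "w \<in> carrier_vec p" "i < p" "x * v $ i + y * w $ i \<noteq> 0"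
  shows "x\<^sup>2 * (l2_norm v)\<^sup>2 + 2 * x * y * (v \<bullet> w) + y\<^sup>2 * (l2_norm w)\<^sup>2 > 0"
  unfolding gram_quadratic[OF assms(1,2), symmetric]
  using assms by (intro sum_pos2[of _ i]) auto

theorem theorem1:
  fixes n1 n2 n p :: nat
    and \<mu>1 \<mu>2 a1 a2 u1 u2 :: "real vec"
    and c11 c22 c12 d1sq d2sq :: real
    and H :: "real mat"
  assumes n1: "n1 \<ge> 1" and n2: "n2 \<ge> 1" and n: "n = n1 + n2"
    and mu: "\<mu>1 \<in> carrier_vec p" "\<mu>2 \<in> carrier_vec p"
    and mu_neq: "\<mu>1 \<noteq> \<mu>2" and mu2_nz: "\<mu>2 \<noteq> 0\<^sub>v p"
    and c11: "c11 = (l2_norm \<mu>1)\<^sup>2"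
    and c22: "c22 = (l2_norm \<mu>2)\<^sup>2"
    and c12: "c12 = \<mu>1 \<bullet> \<mu>2"
    and a1: "a1 \<in> carrier_vec n" "\<forall>i<n. a1 $ i \<in> {0, 1}"
    and a1_card: "card {i. i < n \<and> a1 $ i = 1} = n1"
    and a2: "a2 = vec n (\<lambda>_. 1) - a1"
    and H: "H = c11 \<cdot>\<^sub>m outer_prod a1 a1 + c22 \<cdot>\<^sub>m outer_prod a2 a2
              + c12 \<cdot>\<^sub>m outer_prod a1 a2 + c12 \<cdot>\<^sub>m outer_prod a2 a1"
    and d1sq: "d1sq = eigenvalues_desc H ! 0"
    and d2sq: "d2sq = eigenvalues_desc H ! 1"
    and u1: "eigenvector H u1 d1sq"
    and u2: "eigenvector H u2 d2sq"
    and u_on: "orthonormal_pair u1 u2"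
  shows "d1sq \<ge> d2sq \<and> d2sq \<ge> 0
    \<and> d1sq = 1/2 * (n1 * c11 + n2 * c22 +
        sqrt (n1\<^sup>2 * c11\<^sup>2 + n2\<^sup>2 * c22\<^sup>2 + 4 * n1 * n2 * c12\<^sup>2 - 2 * n1 * n2 * c11 * c22))
    \<and> d2sq = 1/2 * (n1 * c11 + n2 * c22 -
        sqrt (n1\<^sup>2 * c11\<^sup>2 + n2\<^sup>2 * c22\<^sup>2 + 4 * n1 * n2 * c12\<^sup>2 - 2 * n1 * n2 * c11 * c22))
    \<and> (c12\<^sup>2 = c11 * c22 \<longrightarrow>
         d1sq = n1 * c11 + n2 * c22 \<and> d2sq = 0 \<and>
         clustering_power H u1 \<and> \<not> clustering_power H u2)
    \<and> (c12\<^sup>2 \<noteq> c11 * c22 \<and> c12 = 0 \<and> n1 * c11 = n2 * c22 \<longrightarrow>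
         d1sq = n1 * c11 \<and> d2sq = n1 * c11 \<and>
         (clustering_power H u1 \<or> clustering_power H u2))
    \<and> (c12\<^sup>2 \<noteq> c11 * c22 \<and> c12 = 0 \<and> n1 * c11 \<noteq> n2 * c22 \<longrightarrow>
         d1sq = max (n1 * c11) (n2 * c22) \<and> d2sq = min (n1 * c11) (n2 * c22) \<and> d2sq > 0 \<and>
         clustering_power H u1 \<and> clustering_power H u2)
    \<and> (c12\<^sup>2 \<noteq> c11 * c22 \<and> c12 \<noteq> 0 \<longrightarrow>
         (n1 * c11 + n2 * c12 = n2 * c22 + n1 * c12 \<longrightarrow>
            (clustering_power H u1 \<and> \<not> clustering_power H u2) \<or>
            (\<not> clustering_power H u1 \<and> clustering_power H u2)) \<and>
         (n1 * c11 + n2 * c12 \<noteq> n2 * c22 + n1 * c12 \<longrightarrow>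
            clustering_power H u1 \<and> clustering_power H u2))"

proof -
  interpret two_block_gram n1 n2 n a1 a2 c11 c22 c12 H
    by unfold_locales fact+
  obtain j where "j < p" "\<mu>2 $ j \<noteq> 0"
    using mu mu2_nz by (metis carrier_vecD eq_vecI index_zero_vec)
  from gram_positive[OF mu this(1), of 0 1] this(2) have c22_pos: "c22 > 0"
    by (simp add: c22)
  \<comment> \<open>The squared distance of the means is positive; this later rules out
    \<open>c11\<close> = \<open>c12\<close> = \<open>c22\<close>.\<close>
  obtain j where "j < p" "\<mu>1 $ j \<noteq> \<mu>2 $ j"
    using mu mu_neq by (metis carrier_vecD eq_vecI)
  from gram_positive[OF mu this(1), of 1 "-1"] this(2) have diff_pos: "c11 - 2 * c12 + c22 > 0"
    by (simp add: c11 c22 c12)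
  have c11_nonneg: "c11 \<ge> 0" by (simp add: c11)
  \<comment> \<open>Cauchy-Schwarz: the vector is \<open>c22\<close> times the component of the
    first mean orthogonal to the second.\<close>
  have "0 \<le> (\<Sum>i<p. (c22 * \<mu>1 $ i + - c12 * \<mu>2 $ i)\<^sup>2)" by (simp add: sum_nonneg)
  also have "\<dots> = c22 * (c11 * c22 - c12\<^sup>2)"
    unfolding gram_quadratic[OF mu] c11[symmetric] c12[symmetric] c22[symmetric]
    by (simp add: algebra_simps power2_eq_square)
  finally have gram: "c12\<^sup>2 \<le> c11 * c22"
    using c22_pos by (simp add: zero_le_mult_iff)

  \<comment> \<open>The two eigenvalues from trace and determinant\<close>
  define p1 p2 where "p1 = real n1" and "p2 = real n2"
  have p_pos: "p1 > 0" "p2 > 0" using n1 n2 by (simp_all add: p1_def p2_def)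
  define T where "T = p1 * c11 + p2 * c22"
  define D where "D = p1 * p2 * (c11 * c22 - c12\<^sup>2)"
  define S where "S = sqrt (T\<^sup>2 - 4 * D)"
  have T_pos: "T > 0" using p_pos c11_nonneg c22_pos by (simp add: T_def add_nonneg_pos)
  have D_nonneg: "D \<ge> 0" using p_pos gram by (simp add: D_def)
  \<comment> \<open>As a sum of nonnegative terms the discriminant gives a real root, equal to the
    distance of the diagonal entries if \<open>c12 = 0\<close> and positive otherwise.\<close>
  have disc: "T\<^sup>2 - 4 * D = (p1 * c11 - p2 * c22)\<^sup>2 + 4 * p1 * p2 * c12\<^sup>2"
    by (simp add: T_def D_def algebra_simps power2_eq_square)
  have S_sq: "S\<^sup>2 = T\<^sup>2 - 4 * D"
    unfolding S_def disc using p_pos by simp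
  have S_nonneg: "S \<ge> 0"
    unfolding S_def disc using p_pos by simp
  have "S\<^sup>2 \<le> T\<^sup>2"
    using S_sq D_nonneg by linarith
  then have S_le: "S \<le> T"
    using T_pos by (auto intro: power2_le_imp_le)
  have S_stmt: "S = sqrt (n1\<^sup>2 * c11\<^sup>2 + n2\<^sup>2 * c22\<^sup>2 + 4 * n1 * n2 * c12\<^sup>2 - 2 * n1 * n2 * c11 * c22)"
    unfolding S_def disc p1_def p2_def
    by (rule arg_cong[of _ _ sqrt]) (simp add: power2_eq_square algebra_simps)

  have "eigenvalues_desc H = (T + S) / 2 # (T - S) / 2 # replicate (n - 2) 0"
  proof (rule eigenvalues)
    have "(T + S) / 2 * ((T - S) / 2) = (T\<^sup>2 - S\<^sup>2) / 4"
      by (simp add: algebra_simps power2_eq_square)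
    then show "n1 * n2 * (c11 * c22 - c12\<^sup>2) = (T + S) / 2 * ((T - S) / 2)"
      unfolding S_sq by (simp add: D_def p1_def p2_def)
  qed (use S_nonneg S_le in \<open>auto simp: T_def p1_def p2_def field_simps\<close>)
  then have d1: "d1sq = (T + S) / 2" and d2: "d2sq = (T - S) / 2"
    by (simp_all add: d1sq d2sq)
  have d_sum: "d1sq + d2sq = T" and d_diff: "d1sq - d2sq = S"
    by (simp_all add: d1 d2 field_simps)
  have d1_pos: "d1sq > 0" using d1 T_pos S_nonneg by simp
  \<comment> \<open>The product of the eigenvalues is \<open>D\<close>, and the larger one is
    positive.\<close>
  have d2_pos: "d2sq > 0 \<longleftrightarrow> c12\<^sup>2 \<noteq> c11 * c22"
  proof -
    have "d1sq * d2sq = (T\<^sup>2 - S\<^sup>2) / 4"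
      by (simp add: d1 d2 algebra_simps power2_eq_square)
    then have "d1sq * d2sq = D" by (simp add: S_sq)
    then have "d2sq > 0 \<longleftrightarrow> D > 0" using d1_pos by (metis zero_less_mult_pos mult_pos_pos)
    then show ?thesis using p_pos gram by (auto simp: D_def zero_less_mult_iff)
  qed

  \<comment> \<open>Constant and nonconstant eigenvectors\<close>
  obtain \<alpha>1 \<beta>1 where u1_eq: "u1 = vec n (\<lambda>i. if a1 $ i = 1 then \<alpha>1 else \<beta>1)"
    and e1: "d1sq * \<alpha>1 = p1 * c11 * \<alpha>1 + p2 * c12 * \<beta>1" "d1sq * \<beta>1 = p1 * c12 * \<alpha>1 + p2 * c22 * \<beta>1"
    and nz1: "\<alpha>1 \<noteq> 0 \<or> \<beta>1 \<noteq> 0" and card1: "card (vec_set u1) = 2 \<longleftrightarrow> \<alpha>1 \<noteq> \<beta>1"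
    using block_eigenvector[OF u1] d1_pos unfolding p1_def p2_def by (metis less_irrefl)
  have cp1: "clustering_power H u1 \<longleftrightarrow> \<alpha>1 \<noteq> \<beta>1"
    using clustering_power_iff[OF u1] d1_pos card1 by simp

  \<comment> \<open>With equal coordinates the two equations say that both row sums of the 2 by 2
    system equal \<open>d\<close>.\<close>
  have const: "\<alpha> \<noteq> 0 \<and> d = p1 * c11 + p2 * c12 \<and> d = p2 * c22 + p1 * c12"
    if "d * \<alpha> = p1 * c11 * \<alpha> + p2 * c12 * \<beta>" "d * \<beta> = p1 * c12 * \<alpha> + p2 * c22 * \<beta>"
      "\<alpha> \<noteq> 0 \<or> \<beta> \<noteq> 0" "\<alpha> = \<beta>" for d \<alpha> \<beta>
  proof -
    have "d * \<alpha> = (p1 * c11 + p2 * c12) * \<alpha>" "d * \<alpha> = (p2 * c22 + p1 * c12) * \<alpha>" "\<alpha> \<noteq> 0"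
      using that by (simp_all add: algebra_simps)
    then show ?thesis by (simp only: mult_cancel_right) simp
  qed
  \<comment> \<open>When the row sums agree, subtracting the equations leaves a multiple of the
    coordinate difference, so all nonconstant eigenvectors share one eigenvalue.\<close>
  have nonconst: "d = p1 * c11 - p1 * c12"
    if "d * \<alpha> = p1 * c11 * \<alpha> + p2 * c12 * \<beta>" "d * \<beta> = p1 * c12 * \<alpha> + p2 * c22 * \<beta>"
      "\<alpha> \<noteq> \<beta>" "p1 * c11 + p2 * c12 = p2 * c22 + p1 * c12" for d \<alpha> \<beta>
  proof -
    have c22': "p2 * c22 = p1 * c11 + p2 * c12 - p1 * c12" using that(4) by simp
    have "d * (\<alpha> - \<beta>) = (p1 * c11 - p1 * c12) * (\<alpha> - \<beta>)"
      using that(1,2) unfolding c22' by (simp add: algebra_simps)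
    then show ?thesis using that(3) by simp
  qed

  \<comment> \<open>Case analysis\<close>
  have case_a: "d1sq = T \<and> d2sq = 0 \<and> clustering_power H u1 \<and> \<not> clustering_power H u2"
    if eq: "c12\<^sup>2 = c11 * c22"
  proof -
    have "S = T" using S_sq T_pos S_nonneg eq by (simp add: D_def)
    then have d: "d1sq = T" "d2sq = 0" by (simp_all add: d1 d2)
    have "\<alpha>1 \<noteq> \<beta>1"
    proof
      assume "\<alpha>1 = \<beta>1"
      \<comment> \<open>Both row sums would equal the trace \<open>T\<close>, forcing
        \<open>c22 = c12\<close> and \<open>c11 = c12\<close> against
        \<open>diff_pos\<close>.\<close>
      from const[OF e1 nz1 this] have "p2 * (c22 - c12) = 0" "p1 * (c11 - c12) = 0"
        by (simp_all add: d T_def algebra_simps)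
      then show False using diff_pos p_pos by simp
    qed
    then show ?thesis using d cp1 clustering_power_iff[OF u2] by simp
  qed

  have rest: "(c12 = 0 \<and> p1 * c11 = p2 * c22 \<longrightarrow>
         d1sq = p1 * c11 \<and> d2sq = p1 * c11 \<and>
         (clustering_power H u1 \<or> clustering_power H u2))
    \<and> (c12 = 0 \<and> p1 * c11 \<noteq> p2 * c22 \<longrightarrow>
         d1sq = max (p1 * c11) (p2 * c22) \<and> d2sq = min (p1 * c11) (p2 * c22) \<and> d2sq > 0 \<and>
         clustering_power H u1 \<and> clustering_power H u2)
    \<and> (c12 \<noteq> 0 \<longrightarrow>
         (p1 * c11 + p2 * c12 = p2 * c22 + p1 * c12 \<longrightarrow>
            (clustering_power H u1 \<and> \<not> clustering_power H u2) \<or>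
            (\<not> clustering_power H u1 \<and> clustering_power H u2)) \<and>
         (p1 * c11 + p2 * c12 \<noteq> p2 * c22 + p1 * c12 \<longrightarrow>
            clustering_power H u1 \<and> clustering_power H u2))"
    if neq: "c12\<^sup>2 \<noteq> c11 * c22"
  proof -
    have pos: "d2sq > 0" using d2_pos neq by simp
    obtain \<alpha>2 \<beta>2 where u2_eq: "u2 = vec n (\<lambda>i. if a1 $ i = 1 then \<alpha>2 else \<beta>2)"
      and e2: "d2sq * \<alpha>2 = p1 * c11 * \<alpha>2 + p2 * c12 * \<beta>2" "d2sq * \<beta>2 = p1 * c12 * \<alpha>2 + p2 * c22 * \<beta>2"
      and nz2: "\<alpha>2 \<noteq> 0 \<or> \<beta>2 \<noteq> 0" and card2: "card (vec_set u2) = 2 \<longleftrightarrow> \<alpha>2 \<noteq> \<beta>2"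
      using block_eigenvector[OF u2] pos unfolding p1_def p2_def by (metis less_irrefl)
    have cp2: "clustering_power H u2 \<longleftrightarrow> \<alpha>2 \<noteq> \<beta>2"
      using clustering_power_iff[OF u2] pos card2 by simp
    have "0 = (\<Sum>i = 0..<n. if a1 $ i = 1 then \<alpha>1 * \<alpha>2 else \<beta>1 * \<beta>2)"
      using u_on unfolding orthonormal_pair_def u1_eq u2_eq
      by (auto simp: scalar_prod_def if_distrib cong: if_cong intro!: sum.cong)
    then have orth: "p1 * (\<alpha>1 * \<alpha>2) + p2 * (\<beta>1 * \<beta>2) = 0"
      unfolding sum_blocks p1_def p2_def by simp
    \<comment> \<open>Two nonzero constant vectors cannot be orthogonal.\<close>
    have not_both: "\<alpha>1 \<noteq> \<beta>1 \<or> \<alpha>2 \<noteq> \<beta>2"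
    proof (rule ccontr)
      assume "\<not> ?thesis"
      then have c: "\<alpha>1 = \<beta>1" "\<alpha>2 = \<beta>2" by auto
      from orth have "(p1 + p2) * (\<alpha>1 * \<alpha>2) = 0" by (simp add: c algebra_simps)
      then show False using c nz1 nz2 p_pos by auto
    qed
    have both: "\<alpha>1 \<noteq> \<beta>1 \<and> \<alpha>2 \<noteq> \<beta>2" if "p1 * c11 + p2 * c12 \<noteq> p2 * c22 + p1 * c12"
      using const[OF e1 nz1] const[OF e2 nz2] that by auto
    \<comment> \<open>Two nonconstant vectors would have equal eigenvalues, but
      \<open>c12 \<noteq> 0\<close> makes the discriminant positive. With \<open>c12 = 0\<close> the
      eigenvalues may coincide, which is why (b) only claims at least one vector.\<close>
    have one: "\<alpha>1 = \<beta>1 \<or> \<alpha>2 = \<beta>2"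
      if "p1 * c11 + p2 * c12 = p2 * c22 + p1 * c12" "c12 \<noteq> 0"
    proof (rule ccontr)
      assume "\<not> ?thesis"
      then have "S = 0"
        using nonconst[OF e1 _ that(1)] nonconst[OF e2 _ that(1)] d_diff by simp
      moreover have "0 < T\<^sup>2 - 4 * D"
        unfolding disc using p_pos that(2) by (simp add: add_nonneg_pos)
      ultimately show False using S_sq by simp
    qed
    have diag: "d1sq = max (p1 * c11) (p2 * c22) \<and> d2sq = min (p1 * c11) (p2 * c22)" if "c12 = 0"
    proof -
      have "S = \<bar>p1 * c11 - p2 * c22\<bar>" unfolding S_def disc using that by simp
      then show ?thesis by (auto simp: d1 d2 T_def max_def min_def field_simps)
    qed
    \<comment> \<open>Case (b) rests on \<open>not_both\<close>; (c) on \<open>both\<close>, as for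
      \<open>c12 = 0\<close> the row sums are the diagonal entries; (d) on \<open>not_both\<close>
      with \<open>one\<close> for equal row sums and on \<open>both\<close> otherwise.\<close>
    show ?thesis using cp1 cp2 not_both both one diag pos by auto
  qed

  have "d1sq \<ge> d2sq \<and> d2sq \<ge> 0 \<and> d1sq = 1/2 * (T + S) \<and> d2sq = 1/2 * (T - S)"
    using S_nonneg S_le by (simp add: d1 d2)
  with case_a rest show ?thesis
    unfolding S_stmt[symmetric] unfolding p1_def[symmetric] p2_def[symmetric] T_def[symmetric]
    by blast
qed

end
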